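(* For every integer $n\ge 2$, the power sums $s_{n,m}=\sum_{k=1}^{n(n+1)/2}(a_{n,k})^m$ of the roots $a_{n,k}$ of the Yablonskii--Vorob'ev polynomial $Q_n(z)$ satisfy, with $\pi_n=n(n^2-1)(n+2)$, $$s_{n,3}=-\tfrac12\pi_n,$$ $$s_{n,6}=2\pi_n(n^2+n-5),$$ $$s_{n,9}=-4\pi_n(n^2+n-7)(3n^2+3n-20),$$ $$s_{n,12}=8\pi_n[11n^6+33n^5-259n^4-573n^3+2348n^2+2640n-7700],$$ $$s_{n,15}=-8\pi_n[91n^8+364n^7-3468n^6-11678n^5+57138n^4+134164n^3-454161n^2-523250n+1401400],$$ $$s_{n,18}=32\pi_n[204n^{10}+1020n^9-11584n^8-52456n^7+303649n^6+1098827n^5-4328687n^4-10551991n^3+32064418n^2+37532600n-95295200],$$ $$s_{n,21}=-64\pi_n[969n^{12}+5814n^{11}-77478n^{10}-440685n^9+2986374n^8+14653560n^7-66988510n^6-254167821n^5+882020165n^4+2205662532n^3-6249767920n^2-7397539800n+18106088000],$$ $$s_{n,24}=128\pi_n[4807n^{14}+33649n^{13}-519091n^{12}-3551983n^{11}+27883155n^{10}+172777587n^9-911403269n^8-4722725213n^7+18734279962n^6+73498559352n^5-234405400524n^4-597184066192n^3+1610723930960n^2+1922407748800n-4580840264000],$$ $$s_{n,27}=-128\pi_n[49335n^{16}+394680n^{15}-6966616n^{14}-55673212n^{13}+501236020n^{12}+3749125816n^{11}-22662344352n^{10}-149052619326n^9+674231177321n^8+3634840116452n^7-13091078484596n^6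-52664915417010n^5+158038744882088n^4+408412972732600n^3-1061767782349200n^2-1275405591460000n+2977546171600000].$$
   Context: Yablonskii--Vorob'ev polynomials: $Q_0(z)=1$, $Q_1(z)=z$, and $Q_{n+1}Q_{n-1}=zQ_n^2-4\left(Q_nQ_n''-(Q_n')^2\right)$ for $n\ge 1$. Known facts taken as given: each $Q_n$ is a monic polynomial with integer coefficients, of degree $n(n+1)/2$, with only simple roots, and for $n\ge1$ the function $w(z;n)=\frac{d}{dz}\ln\frac{Q_{n-1}(z)}{Q_n(z)}$ is a rational solution of the second Painlevé equation $w_{zz}=2w^3+zw+\alpha$ with $\alpha=n$. *)

theory Defs
  imports
    "HOL-Computational_Algebra.Computational_Algebra"
    "HOL-Computational_Algebra.Field_as_Ring"
begin

text \<open>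
  The Yablonskii--Vorob'ev polynomials over the complex numbers; \<open>[:0, 1:]\<close> is the variable
  \<open>z\<close>. The recurrence is solved for the next polynomial by polynomial division, which is exact:
  \<open>yv_recurrence\<close> below is the recurrence in product form.
\<close>

definition yv_rhs :: "complex poly \<Rightarrow> complex poly" where
  "yv_rhs q = [:0, 1:] * q ^ 2 - 4 * (q * pderiv (pderiv q) - (pderiv q) ^ 2)"

fun yv :: "nat \<Rightarrow> complex poly" where
  "yv 0 = 1"
| "yv (Suc 0) = [:0, 1:]"
| "yv (Suc (Suc n)) = yv_rhs (yv (Suc n)) div yv n"

text \<open>
  Roots are counted with multiplicity, so there are \<open>n(n+1)/2\<close> of them, the degree of
  \<open>yv n\<close>.
\<close>

definition yv_power_sum :: "nat \<Rightarrow> nat \<Rightarrow> complex" where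
  "yv_power_sum n m = (\<Sum>a\<in>#proots (yv n). a ^ m)"

definition yv_pi :: "complex \<Rightarrow> complex" where
  "yv_pi N = N * (N ^ 2 - 1) * (N + 2)"


subsection \<open>Exactness of the division\<close>

text \<open>
  For \<open>f, g, h\<close> three consecutive polynomials: the recurrence, the bilinear equation
  \<open>f''g - 2f'g' + fg'' = 0\<close>, and the Wronskian identity \<open>h'f - hf' = (2n + 1) g\<^sup>2\<close>.
\<close>

definition yv_inv :: "nat \<Rightarrow> complex poly \<Rightarrow> complex poly \<Rightarrow> complex poly \<Rightarrow> bool" where
  "yv_inv n f g h \<longleftrightarrow>
     f * h = yv_rhs g \<and>
     pderiv (pderiv f) * g - 2 * pderiv f * pderiv g + f * pderiv (pderiv g) = 0 \<and>
     pderiv h * f - h * pderiv f = of_nat (2 * n + 1) * g ^ 2 \<and>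
     coprime f g \<and> g dvd yv_rhs f \<and> f \<noteq> 0 \<and> g \<noteq> 0"

lemma pderiv_X [simp]: "pderiv [:0, 1:] = (1 :: complex poly)"
  by (simp add: pderiv_pCons one_pCons)

lemma no_common_root_imp_coprime:
  fixes p q :: "complex poly"
  assumes "p \<noteq> 0" "\<And>x. poly p x = 0 \<Longrightarrow> poly q x = 0 \<Longrightarrow> False"
  shows "coprime p q"
proof (rule ccontr)
  assume "\<not> coprime p q"
  then obtain d where d: "d dvd p" "d dvd q" "\<not> is_unit d" by (auto simp: coprime_def)
  with assms(1) have "degree d \<noteq> 0" by (auto simp: is_unit_iff_degree)
  hence "\<not> constant (poly d)" by (simp add: constant_degree)
  then obtain x where "poly d x = 0" using fundamental_theorem_of_algebra by blast
  hence "[:-x, 1:] dvd d" by (simp add: poly_eq_0_iff_dvd)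
  hence "[:-x, 1:] dvd p" "[:-x, 1:] dvd q" by (auto intro: dvd_trans d)
  with assms(2)[of x] show False by (simp add: poly_eq_0_iff_dvd)
qed

lemma yv_inv_coprime:
  assumes "yv_inv n f g h" shows "coprime g h"
proof (rule no_common_root_imp_coprime)
  show g0: "g \<noteq> 0" using assms by (simp add: yv_inv_def)
  fix x assume gx: "poly g x = 0" and hx: "poly h x = 0"
  let ?X = "[:-x, 1:]"
  from assms have T: "f * h = yv_rhs g" and cop: "coprime f g"
    and R: "pderiv (pderiv f) * g - 2 * pderiv f * pderiv g + f * pderiv (pderiv g) = 0"
    by (auto simp: yv_inv_def)
  have "poly (f * h) x = poly (yv_rhs g) x" using T by simp
  hence g'x: "poly (pderiv g) x = 0"
    using gx hx by (simp add: yv_rhs_def)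
  have fx: "poly f x \<noteq> 0"
  proof
    assume "poly f x = 0"
    hence "?X dvd f" "?X dvd g" using gx by (simp_all add: poly_eq_0_iff_dvd)
    hence "is_unit ?X" using cop by (meson coprime_common_divisor)
    thus False by (simp add: is_unit_iff_degree)
  qed
  define m where "m = order x g"
  have g'0: "pderiv g \<noteq> 0"
  proof
    assume "pderiv g = 0"
    hence "degree g = 0" by (simp add: pderiv_eq_0_iff)
    with gx g0 show False by (metis degree_eq_zeroE pCons_0_0 poly_0 poly_pCons add.right_neutral mult_zero_right)
  qed
  have o1: "m = Suc (order x (pderiv g))"
    using order_pderiv[of g x] g0 gx by (simp add: m_def)
  have g''0: "pderiv (pderiv g) \<noteq> 0"
  proof
    assume "pderiv (pderiv g) = 0"
    hence "degree (pderiv g) = 0" by (simp add: pderiv_eq_0_iff)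
    with g'x g'0 show False by (metis degree_eq_zeroE pCons_0_0 poly_0 poly_pCons add.right_neutral mult_zero_right)
  qed
  have o2: "order x (pderiv g) = Suc (order x (pderiv (pderiv g)))"
    using order_pderiv[of "pderiv g" x] g'0 g'x by simp
  have d1: "?X ^ order x (pderiv g) dvd pderiv g" by (rule order_1)
  have d0: "?X ^ order x (pderiv g) dvd g"
    using o1 unfolding m_def by (metis order_1 le_SucI order_refl power_le_dvd)
  have "f * pderiv (pderiv g) = 2 * pderiv f * pderiv g - pderiv (pderiv f) * g"
    using R by (simp add: algebra_simps)
  also have "?X ^ order x (pderiv g) dvd \<dots>" using d0 d1 by (intro dvd_diff dvd_mult)
  finally have "order x (pderiv g) \<le> order x (f * pderiv (pderiv g))"
    using g''0 fx by (subst (asm) order_divides) auto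
  also have "\<dots> = order x (pderiv (pderiv g))"
    using g''0 fx by (subst order_mult) (auto simp: order_0I)
  finally show False using o2 by simp
qed

lemma yv_inv_next_hirota:
  assumes "yv_inv n f g h"
  shows "pderiv (pderiv g) * h - 2 * pderiv g * pderiv h + g * pderiv (pderiv h) = 0"
proof -
  from assms have f0: "f \<noteq> 0"
    and R: "pderiv (pderiv f) * g - 2 * pderiv f * pderiv g + f * pderiv (pderiv g) = 0"
    and S: "pderiv h * f - h * pderiv f = of_nat (2 * n + 1) * g ^ 2"
    by (auto simp: yv_inv_def)
  have "pderiv (pderiv h * f - h * pderiv f) = pderiv (of_nat (2 * n + 1) * g ^ 2)"
    using S by simp
  hence S': "pderiv (pderiv h) * f - h * pderiv (pderiv f) = of_nat (2 * n + 1) * (2 * g * pderiv g)"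
    unfolding power2_eq_square pderiv_mult pderiv_diff pderiv_of_nat by algebra
  have "f * (pderiv (pderiv g) * h - 2 * pderiv g * pderiv h + g * pderiv (pderiv h)) = 0"
    using R S S' by algebra
  thus ?thesis using f0 by simp
qed

lemma pderiv_rhs:
  "pderiv (yv_rhs q) = q ^ 2 + 2 * [:0, 1:] * q * pderiv q
     - 4 * (q * pderiv (pderiv (pderiv q)) - pderiv q * pderiv (pderiv q))"
  unfolding yv_rhs_def power2_eq_square pderiv_mult pderiv_diff pderiv_add pderiv_X pderiv_numeral
  by algebra

lemma yv_rhs_mult:
  "yv_rhs (f * h) = f ^ 2 * yv_rhs h + h ^ 2 * yv_rhs f - [:0, 1:] * f ^ 2 * h ^ 2"
  unfolding yv_rhs_def pderiv_mult pderiv_add by algebra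

lemma yv_inv_dvd:
  assumes "yv_inv n f g h" shows "g dvd yv_rhs h"
proof -
  from assms have T: "f * h = yv_rhs g" and cop: "coprime f g" and d: "g dvd yv_rhs f"
    by (auto simp: yv_inv_def)
  let ?x = "[:0, 1:] :: complex poly"
  define a b c d4 where "a = pderiv g" and "b = pderiv a" and "c = pderiv b" and "d4 = pderiv c"
  have P: "yv_rhs g = ?x * g ^ 2 - 4 * (g * b - a ^ 2)"
    by (simp add: yv_rhs_def a_def b_def)
  have P1: "pderiv (yv_rhs g) = g ^ 2 + 2 * ?x * g * a - 4 * (g * c - a * b)"
    by (simp add: pderiv_rhs a_def b_def c_def)
  have P2: "pderiv (pderiv (yv_rhs g)) =
      4 * g * a + 2 * ?x * a ^ 2 + 2 * ?x * g * b - 4 * (g * d4 - b ^ 2)"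
    unfolding P1 power2_eq_square pderiv_mult pderiv_diff pderiv_add pderiv_X pderiv_numeral
      a_def[symmetric] b_def[symmetric] c_def[symmetric] d4_def[symmetric]
    by algebra
  define e where "e = 2 *  ?x^3 * g^3 - 24 *  ?x^2 * g^2 * b + 24 *  ?x^2 * g * a^2 + 48 *  ?x * g * b^2 +
      16 *  ?x * g^2 * d4 + 96 * g * a * b - 64 * g * b * d4 + 64 * b^3 - 64 * a^3 + 64 *
      a^2 * d4 + 4 * g^3 - 32 * g^2 * c - 64 *  ?x * g * a * c + 64 * g * c^2 - 128 * a * b
      * c"
  have e: "yv_rhs (yv_rhs g) + ?x * (yv_rhs g) ^ 2 = g * e"
    unfolding yv_rhs_def[of "yv_rhs g"] P2 unfolding P1 unfolding P e_def
    by algebra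
  obtain k where k: "yv_rhs f = g * k" using d by (elim dvdE)
  have "yv_rhs (yv_rhs g) = f ^ 2 * yv_rhs h + h ^ 2 * yv_rhs f - ?x * f ^ 2 * h ^ 2"
    using yv_rhs_mult[of f h] T by simp
  hence "f ^ 2 * yv_rhs h = g * (e - h ^ 2 * k)"
    using e k T by algebra
  hence "g dvd f ^ 2 * yv_rhs h" by simp
  moreover have "coprime g (f ^ 2)" using cop by (simp add: coprime_commute)
  ultimately show ?thesis by (simp add: coprime_dvd_mult_right_iff)
qed

lemma yv_inv_step:
  assumes inv: "yv_inv n f g h" and T': "g * k = yv_rhs h"
  shows "yv_inv (Suc n) g h k"
proof -
  from inv have T: "f * h = yv_rhs g" and f0: "f \<noteq> 0" and g0: "g \<noteq> 0"
    and R: "pderiv (pderiv f) * g - 2 * pderiv f * pderiv g + f * pderiv (pderiv g) = 0"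
    and S: "pderiv h * f - h * pderiv f = of_nat (2 * n + 1) * g ^ 2"
    by (auto simp: yv_inv_def)
  have h0: "h \<noteq> 0"
  proof
    assume "h = 0"
    hence "of_nat (2 * n + 1) * g ^ 2 = 0" using S by simp
    thus False using g0 by (simp del: of_nat_Suc of_nat_add)
  qed
  let ?x = "[:0, 1:] :: complex poly"
  define a b c where "a = pderiv g" and "b = pderiv a" and "c = pderiv b"
  define p q r where "p = pderiv h" and "q = pderiv p" and "r = pderiv q"
  define f1 C :: "complex poly" where "f1 = pderiv f" and "C = of_nat (2 * n + 1)"
  note ds = a_def[symmetric] b_def[symmetric] c_def[symmetric]
    p_def[symmetric] q_def[symmetric] r_def[symmetric]
  have R2: "b * h - 2 * a * p + g * q = 0"
    using yv_inv_next_hirota[OF inv] by (simp add: ds)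
  have "pderiv (b * h - 2 * a * p + g * q) = 0" using R2 by simp
  hence R2': "c * h - b * p - a * q + g * r = 0"
    unfolding pderiv_mult pderiv_diff pderiv_add ds pderiv_numeral by algebra
  have T1: "f * h = ?x * g ^ 2 - 4 * (g * b - a ^ 2)"
    using T by (simp add: yv_rhs_def ds)
  have "pderiv (f * h) = pderiv (yv_rhs g)" using T by simp
  hence T2: "f1 * h + f * p = g ^ 2 + 2 * ?x * g * a - 4 * (g * c - a * b)"
    unfolding pderiv_rhs pderiv_mult ds f1_def by algebra
  have S1: "p * f - h * f1 = C * g ^ 2" using S by (simp add: ds f1_def C_def)
  have X: "2 * (p * f) = (C + 1) * g ^ 2 + 2 * ?x * g * a - 4 * g * c + 4 * a * b"
    using T2 S1 by algebra
  define B where "B = 2 * ?x * (g * p - a * h) + 4 * c * h - 8 * b * p + 4 * a * q"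
  have gq: "g * q * f = 2 * a * (p * f) - b * (f * h)" using R2 by algebra
  have "g * f * B = 2 * ?x * g * (g * (p * f) - a * (f * h)) + 4 * g * c * (f * h)
      - 8 * g * b * (p * f) + 4 * a * (g * q * f)"
    unfolding B_def by algebra
  also have "\<dots> = 2 * (p * f) * (?x * g ^ 2 - 4 * (g * b - a ^ 2)) +
      (f * h) * (4 * g * c - 4 * a * b - 2 * ?x * g * a)"
    unfolding gq by algebra
  also have "\<dots> = (f * h) * ((C + 1) * g ^ 2)"
    unfolding T1[symmetric] X by algebra
  finally have "g * f * (B - (C + 1) * g * h) = 0" by algebra
  hence B: "B = (C + 1) * g * h" using f0 g0 by simp
  have T3: "g * k = ?x * h ^ 2 - 4 * (h * q - p ^ 2)"
    using T' by (simp add: yv_rhs_def ds)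
  have "pderiv (g * k) = pderiv (yv_rhs h)" using T' by simp
  hence T4: "a * k + g * pderiv k = h ^ 2 + 2 * ?x * h * p - 4 * (h * r - p * q)"
    unfolding pderiv_rhs pderiv_mult ds by algebra
  have "g * (pderiv k * g - k * a) = g * (h ^ 2 + 2 * ?x * h * p - 4 * (h * r - p * q)) -
      2 * a * (?x * h ^ 2 - 4 * (h * q - p ^ 2))"
    using T3 T4 by algebra
  also have "\<dots> = h * (g * h + B)"
    using R2 R2' unfolding B_def by algebra
  also have "\<dots> = g * ((C + 2) * h ^ 2)" unfolding B by algebra
  finally have "pderiv k * g - k * a = (C + 2) * h ^ 2" using g0 by simp
  moreover have "C + 2 = of_nat (2 * Suc n + 1)" by (simp add: C_def)
  moreover have "h dvd yv_rhs g" using T by (metis dvd_triv_right)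
  ultimately show ?thesis
    using T' yv_inv_next_hirota[OF inv] yv_inv_coprime[OF inv] g0 h0
    unfolding yv_inv_def a_def by simp
qed

lemma yv_inv_yv: "yv_inv (Suc n) (yv n) (yv (Suc n)) (yv (Suc (Suc n)))"
proof (induction n)
  case 0
  have "yv (Suc (Suc 0)) = yv_rhs [:0, 1:]" by (simp flip: one_pCons)
  moreover have "coprime 1 ([:0, 1:] :: complex poly)"
    by simp
  ultimately show ?case
    by (simp add: yv_inv_def yv_rhs_def pderiv_mult pderiv_diff pderiv_add power2_eq_square
        pderiv_pCons one_pCons numeral_poly)
next
  case (Suc n)
  have "yv (Suc n) * yv (Suc (Suc (Suc n))) = yv_rhs (yv (Suc (Suc n)))"
    using yv_inv_dvd[OF Suc.IH] by simp
  from yv_inv_step[OF Suc.IH this] show ?case .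
qed

theorem yv_recurrence:
  assumes "n \<ge> 1"
  shows "yv (n + 1) * yv (n - 1) =
    [:0, 1:] * yv n ^ 2 - 4 * (yv n * pderiv (pderiv (yv n)) - (pderiv (yv n)) ^ 2)"
  using assms yv_inv_yv[of "n - 1"] by (cases n) (simp_all add: yv_inv_def yv_rhs_def mult.commute)

end

theory Submission
  imports Defs
begin

text \<open>
  Let \<open>u = Q'/Q\<close> for \<open>Q = yv n\<close>; its expansion at infinity is \<open>\<Sum>m. s\<^sub>m z\<^sup>-\<^sup>m\<^sup>-\<^sup>1\<close>, with \<open>s\<^sub>m\<close>
  the power sums of the roots. For \<open>a = z - 4u'\<close> the recurrence says that \<open>a\<close> is the quotient of
  the two neighbours' product by \<open>Q\<^sup>2\<close>, so together with the Wronskian identity it expresses the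
  logarithmic derivatives of both neighbours through \<open>u\<close>. The bilinear equation then becomes
  \<open>2aa'' - a'\<^sup>2 + 8u'a\<^sup>2 + (2n + 1)\<^sup>2 = 0\<close> (Painleve XXXIV), and differentiating it removes the
  constant and gives \<open>u'''' + 12u'u'' = 2u' + zu''\<close>, that is, \<open>u''' + 6u'\<^sup>2 = u + zu'\<close>. Comparing
  coefficients gives a quadratic recurrence for the \<open>s\<^sub>m\<close> which starts from \<open>s\<^sub>0 = n(n + 1)/2\<close> and
  \<open>s\<^sub>1 = s\<^sub>2 = 0\<close>.
\<close>

section \<open>Expansion of polynomials at infinity\<close>

text \<open>Laurent series are taken in \<open>1/z\<close>, so \<open>fls_X_inv\<close> is \<open>z\<close> and \<open>d/dz\<close> is \<open>- X\<^sup>2 d/dX\<close>.\<close>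

definition at_inf :: "complex poly \<Rightarrow> complex fls" where
  "at_inf p = poly (map_poly fls_const p) fls_X_inv"

lemma at_inf_0 [simp]: "at_inf 0 = 0"
  by (simp add: at_inf_def)

lemma at_inf_pCons: "at_inf (pCons a p) = fls_const a + fls_X_inv * at_inf p"
  by (simp add: at_inf_def map_poly_pCons)

lemma at_inf_1 [simp]: "at_inf 1 = 1"
  by (simp add: one_pCons at_inf_pCons)

lemma at_inf_X [simp]: "at_inf [:0, 1:] = fls_X_inv"
  by (simp add: at_inf_pCons)

lemma at_inf_add: "at_inf (p + q) = at_inf p + at_inf q"
  by (induction p q rule: poly_induct2)
    (simp_all add: at_inf_pCons algebra_simps flip: fls_plus_const)

lemma at_inf_smult: "at_inf (smult c p) = fls_const c * at_inf p"
  by (induction p) (simp_all add: at_inf_pCons algebra_simps flip: fls_const_mult_const)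

lemma at_inf_mult: "at_inf (p * q) = at_inf p * at_inf q"
  by (induction p) (simp_all add: at_inf_pCons at_inf_add at_inf_smult algebra_simps)

lemma at_inf_diff: "at_inf (p - q) = at_inf p - at_inf q"
  using at_inf_add[of "p - q" q] by simp

lemma at_inf_power: "at_inf (p ^ k) = at_inf p ^ k"
  by (induction k) (simp_all add: at_inf_mult)

lemma at_inf_of_nat: "at_inf (of_nat k) = of_nat k"
  by (induction k) (simp_all add: at_inf_add)

lemma at_inf_numeral: "at_inf (numeral k) = numeral k"
  using at_inf_of_nat[of "numeral k"] by simp

lemma at_inf_prod_mset: "at_inf (\<Prod>p\<in>#A. f p) = (\<Prod>p\<in>#A. at_inf (f p))"
  by (induction A) (simp_all add: at_inf_mult)

section \<open>Differentiation with respect to \<open>z\<close>\<close>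

definition zderiv :: "complex fls \<Rightarrow> complex fls" where
  "zderiv F = - (fls_X ^ 2 * fls_deriv F)"

lemma zderiv_add: "zderiv (F + G) = zderiv F + zderiv G"
  by (simp add: zderiv_def algebra_simps)

lemma zderiv_diff: "zderiv (F - G) = zderiv F - zderiv G"
  by (simp add: zderiv_def algebra_simps)

lemma zderiv_mult: "zderiv (F * G) = zderiv F * G + F * zderiv G"
  by (simp add: zderiv_def algebra_simps)

lemma zderiv_const [simp]: "zderiv (fls_const c) = 0"
  by (simp add: zderiv_def)

lemma zderiv_0 [simp]: "zderiv 0 = 0"
  by (simp add: zderiv_def)

lemma zderiv_numeral [simp]: "zderiv (numeral k) = 0"
  by (simp add: zderiv_def)

lemma zderiv_of_nat [simp]: "zderiv (of_nat k) = 0"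
  by (simp add: zderiv_def)

lemma fls_X_inv_times_X: "fls_X_inv * fls_X = (1 :: complex fls)"
  by (simp add: fls_X_inv_times_conv_shift)

lemma zderiv_X_inv [simp]: "zderiv fls_X_inv = 1"
proof -
  have "zderiv fls_X_inv = (fls_X_inv * fls_X) ^ 2"
    unfolding zderiv_def fls_deriv_X_inv by algebra
  thus ?thesis by (simp add: fls_X_inv_times_X)
qed

lemma at_inf_pderiv: "at_inf (pderiv p) = zderiv (at_inf p)"
  by (induction p) (simp_all add: pderiv_pCons at_inf_pCons at_inf_add zderiv_add zderiv_mult)

section \<open>Logarithmic derivatives and power sums\<close>

text \<open>The sum of \<open>1/(z - a)\<close> over the \<open>a\<close> in \<open>A\<close>, expanded in \<open>X = 1/z\<close>.\<close>

definition power_sum_fps :: "complex multiset \<Rightarrow> complex fps" where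
  "power_sum_fps A = Abs_fps (\<lambda>k. if k = 0 then 0 else \<Sum>a\<in>#A. a ^ (k - 1))"

text \<open>Geometric series: \<open>1/(z - a) = X/(1 - a X)\<close>.\<close>

lemma linear_times_power_sum_fps:
  "(fls_X_inv - fls_const a) * fps_to_fls (power_sum_fps {#a#}) = 1"
proof -
  have "(1 - fps_const a * fps_X) * power_sum_fps {#a#} = fps_X"
  proof (rule fps_ext)
    show "((1 - fps_const a * fps_X) * power_sum_fps {#a#}) $ k = fps_X $ k" for k
      by (cases k; cases "k - 1")
        (simp_all add: power_sum_fps_def left_diff_distrib mult.assoc)
  qed
  hence "fps_to_fls ((1 - fps_const a * fps_X) * power_sum_fps {#a#}) = fls_X"
    by simp
  hence "(1 - fls_const a * fls_X) * fps_to_fls (power_sum_fps {#a#}) = fls_X"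
    by (simp add: fls_times_fps_to_fls)
  hence "fls_X_inv * (1 - fls_const a * fls_X) * fps_to_fls (power_sum_fps {#a#}) = 1"
    using fls_X_inv_times_X by (simp add: mult.assoc)
  thus ?thesis using fls_X_inv_times_X by algebra
qed

lemma power_sum_fps_add_mset:
  "power_sum_fps (add_mset a A) = power_sum_fps {#a#} + power_sum_fps A"
  by (rule fps_ext) (simp add: power_sum_fps_def)

lemma zderiv_prod_linear:
  "zderiv (\<Prod>a\<in>#A. fls_X_inv - fls_const a)
     = (\<Prod>a\<in>#A. fls_X_inv - fls_const a) * fps_to_fls (power_sum_fps A)"
proof (induction A)
  case empty
  have "power_sum_fps {#} = 0" by (rule fps_ext) (simp add: power_sum_fps_def)
  moreover have "zderiv 1 = 0" using zderiv_const[of 1] by (simp only: fls_const_1)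
  ultimately show ?case by simp
next
  case (add a A)
  define P where "P = (\<Prod>a\<in>#A. fls_X_inv - fls_const a)"
  define l where "l = fls_X_inv - fls_const a"
  have "l * fps_to_fls (power_sum_fps {#a#}) = 1"
    unfolding l_def by (rule linear_times_power_sum_fps)
  hence "zderiv (l * P)
      = l * fps_to_fls (power_sum_fps {#a#}) * P + l * (P * fps_to_fls (power_sum_fps A))"
    using add.IH unfolding zderiv_mult l_def zderiv_diff zderiv_X_inv zderiv_const P_def by simp
  also have "\<dots> = l * P * fps_to_fls (power_sum_fps (add_mset a A))"
    unfolding power_sum_fps_add_mset[of a A] fps_to_fls_plus by (simp only: algebra_simps)
  finally show ?case by (simp add: l_def P_def)
qed

lemma at_inf_factor:
  "at_inf p = fls_const (lead_coeff p) * (\<Prod>a\<in>#proots p. fls_X_inv - fls_const a)"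
proof -
  have "at_inf p = at_inf (smult (lead_coeff p) (\<Prod>a\<in>#proots p. [:-a, 1:]))"
    by (simp only: complex_poly_decompose_multiset)
  thus ?thesis by (simp add: at_inf_smult at_inf_prod_mset at_inf_pCons)
qed

text \<open>Laurent series have no zero divisors and each \<open>z - a\<close> is invertible, so
  only the leading coefficient can vanish. This permits cancelling expansions of nonzero
  polynomials.\<close>

lemma at_inf_eq_0_iff: "at_inf p = 0 \<longleftrightarrow> p = 0"
proof
  have "fls_X_inv - fls_const a \<noteq> 0" for a :: complex
    using linear_times_power_sum_fps[of a] by auto
  moreover assume "at_inf p = 0"
  ultimately show "p = 0"
    by (auto simp: at_inf_factor prod_mset_zero_iff)
qed auto

lemma zderiv_at_inf:
  "zderiv (at_inf p) = at_inf p * fps_to_fls (power_sum_fps (proots p))"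
  by (simp add: at_inf_factor[of p] zderiv_mult zderiv_prod_linear)

section \<open>The Painleve XXXIV equation and its derivative\<close>

lemma yv_log_deriv_ode:
  assumes inv: "yv_inv n f g h" and h0: "h \<noteq> 0"
  defines "u \<equiv> fps_to_fls (power_sum_fps (proots g))"
  shows "zderiv (zderiv (zderiv (zderiv u)))
           = fls_X_inv * zderiv (zderiv u) + 2 * zderiv u - 12 * zderiv u * zderiv (zderiv u)"
proof -
  define F G H where "F = at_inf f" and "G = at_inf g" and "H = at_inf h"
  define p q where "p = fps_to_fls (power_sum_fps (proots h))"
    and "q = fps_to_fls (power_sum_fps (proots f))"
  define c :: "complex fls" where "c = of_nat (2 * n + 1)"
  define u1 u2 u3 u4 where "u1 = zderiv u" and "u2 = zderiv u1" and "u3 = zderiv u2"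
    and "u4 = zderiv u3"
  define p1 where "p1 = zderiv p"
  define z :: "complex fls" where "z = fls_X_inv"
  note du = u1_def[symmetric] u2_def[symmetric] u3_def[symmetric] u4_def[symmetric]
  have c': "zderiv c = 0" unfolding c_def by (rule zderiv_of_nat)
  have z': "zderiv z = 1" by (simp add: z_def)
  have nz: "F \<noteq> 0" "G \<noteq> 0" "H \<noteq> 0"
    using inv h0 by (auto simp: F_def G_def H_def at_inf_eq_0_iff yv_inv_def)
  have F': "zderiv F = F * q" and G': "zderiv G = G * u" and H': "zderiv H = H * p"
    by (simp_all add: F_def G_def H_def p_def q_def u_def zderiv_at_inf)
  have "at_inf (f * h) = at_inf (yv_rhs g)" using inv by (simp add: yv_inv_def)
  \<comment> \<open>Since \<open>G G'' - G'^2 = G^2 u'\<close>, the right-hand side of the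
    recurrence has the factor \<open>G^2\<close>.\<close>
  hence T: "F * H = G ^ 2 * (z - 4 * u1)"
    unfolding yv_rhs_def at_inf_diff at_inf_mult at_inf_power at_inf_pderiv at_inf_X at_inf_numeral
      F_def[symmetric] G_def[symmetric] H_def[symmetric] G' zderiv_mult du z_def
    by algebra
  have "at_inf (pderiv h * f - h * pderiv f) = at_inf (of_nat (2 * n + 1) * g ^ 2)"
    using inv by (simp add: yv_inv_def)
  hence S: "F * H * (p - q) = c * G ^ 2"
    unfolding at_inf_diff at_inf_mult at_inf_power at_inf_pderiv at_inf_of_nat
      F_def[symmetric] G_def[symmetric] H_def[symmetric] F' H' c_def
    by algebra
  have "at_inf (pderiv (pderiv g) * h - 2 * pderiv g * pderiv h + g * pderiv (pderiv h)) = 0"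
    using yv_inv_next_hirota[OF inv] by simp
  \<comment> \<open>Here \<open>G'' = G (u' + u^2)\<close> and
    \<open>H'' = H (p' + p^2)\<close>.\<close>
  hence "G * H * (u1 + u ^ 2 - 2 * u * p + p1 + p ^ 2) = 0"
    unfolding at_inf_diff at_inf_add at_inf_mult at_inf_power at_inf_pderiv at_inf_numeral
      G_def[symmetric] H_def[symmetric] G' H' zderiv_mult du p1_def
    by algebra
  hence R: "u1 + u ^ 2 - 2 * u * p + p1 + p ^ 2 = 0" using nz by simp
  define a where "a = z - 4 * u1"
  define a1 a2 a3 where "a1 = zderiv a" and "a2 = zderiv a1" and "a3 = zderiv a2"
  note da = a1_def[symmetric] a2_def[symmetric] a3_def[symmetric]
  have a0: "a \<noteq> 0" using T nz by (auto simp: a_def)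
  \<comment> \<open>Differentiating \<open>F H = G^2 a\<close> gives \<open>p + q\<close>, while
    \<open>S\<close> gives \<open>p - q = c/a\<close>; adding the two eliminates
    \<open>q\<close>.\<close>
  have "zderiv (F * H) = zderiv (G * G * a)" using T by (simp add: a_def power2_eq_square)
  hence "F * H * (p + q) = G ^ 2 * (2 * u * a + a1)"
    unfolding zderiv_mult F' G' H' da by algebra
  hence "G ^ 2 * (a * (2 * p)) = G ^ 2 * (a1 + 2 * u * a + c)"
    using S T unfolding a_def[symmetric] by algebra
  hence w: "2 * a * p = a1 + 2 * u * a + c" using nz by (simp add: mult_ac)
  hence "zderiv (2 * a * p) = zderiv (a1 + 2 * u * a + c)" by simp
  hence w1: "2 * a1 * p + 2 * a * p1 = a2 + 2 * u1 * a + 2 * u * a1"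
    unfolding zderiv_mult zderiv_add da du p1_def[symmetric] c' zderiv_numeral by algebra
  \<comment> \<open>With \<open>v = p - u = (a1 + c)/(2a)\<close>, \<open>R\<close> reads
    \<open>2u' + v' + v^2 = 0\<close>. After multiplication by \<open>4a^2\<close> the terms linear
    in \<open>c\<close> cancel.\<close>
  have P34: "2 * a * a2 - a1 ^ 2 + 8 * u1 * a ^ 2 + c ^ 2 = 0"
    using R w w1 by algebra
  hence "zderiv (2 * a * a2 - a1 * a1 + 8 * u1 * a * a + c * c) = 0"
    by (simp add: power2_eq_square mult.assoc)
  \<comment> \<open>The products \<open>a1 * a2\<close> cancel, which leaves the common factor
    \<open>2 * a\<close>.\<close>
  hence "2 * a * (a3 + 4 * u2 * a + 8 * u1 * a1) = 0"
    unfolding zderiv_mult zderiv_add zderiv_diff da du c' zderiv_numeral by algebra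
  hence *: "a3 + 4 * u2 * a + 8 * u1 * a1 = 0" using a0 by simp
  have a1: "a1 = 1 - 4 * u2"
    unfolding a1_def a_def zderiv_diff zderiv_mult du z' by simp
  have a2: "a2 = - 4 * u3" using zderiv_const[of 1]
    unfolding a2_def a1 zderiv_diff zderiv_mult du by simp
  have a3: "a3 = - 4 * u4" using zderiv_const[of "-4"]
    unfolding a3_def a2 zderiv_diff zderiv_mult du by simp
  have "4 * (u4 - (z * u2 + 2 * u1 - 12 * u1 * u2)) = 0"
    using * unfolding a1 a3 a_def by algebra
  hence "u4 - (z * u2 + 2 * u1 - 12 * u1 * u2) = 0"
    by (simp only: mult_eq_0_iff) simp
  thus ?thesis by (simp add: u4_def u3_def u2_def u1_def z_def)
qed

section \<open>The integrated equation and the recurrence for the power sums\<close>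

definition zderiv_fps :: "complex fps \<Rightarrow> complex fps" where
  "zderiv_fps F = - (fps_X ^ 2 * fps_deriv F)"

lemma zderiv_fps_to_fls: "zderiv (fps_to_fls F) = fps_to_fls (zderiv_fps F)"
  by (simp add: zderiv_def zderiv_fps_def fls_deriv_fps_to_fls fls_times_fps_to_fls fps_to_fls_power)

text \<open>Used to fix the constant of integration.\<close>

lemma zderiv_eq_0D: "zderiv (fps_to_fls F) = 0 \<Longrightarrow> F $ 0 = 0 \<Longrightarrow> F = 0"
  by (simp add: zderiv_fps_to_fls zderiv_fps_def fps_deriv_eq_0_iff)

lemma zderiv_fps_nth:
  "zderiv_fps F $ k = (if k < 2 then 0 else - (of_nat (k - 1) * F $ (k - 1)))"
proof -
  have "k - 2 + 1 = k - 1" if "k \<ge> 2" using that by simp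
  thus ?thesis by (auto simp: zderiv_fps_def fps_X_power_mult_nth)
qed

lemma yv_nonzero: "yv n \<noteq> 0"
  using yv_inv_yv[of n] by (simp add: yv_inv_def)

text \<open>The derivative of the left-hand side vanishes by the fourth-order equation. Writing
  \<open>- z u'\<close> as \<open>X dU/dX\<close> keeps every term a power series.\<close>

lemma yv_log_deriv_ode_fps:
  assumes "n \<ge> 1"
  defines "U \<equiv> power_sum_fps (proots (yv n))"
  shows "zderiv_fps (zderiv_fps (zderiv_fps U)) + 6 * zderiv_fps U ^ 2 - U
      + fps_X * fps_deriv U = 0"
    (is "?E = 0")
proof (rule zderiv_eq_0D)
  define u where "u = fps_to_fls U"
  have "fls_X_inv * zderiv u = - (fls_X_inv * fls_X) * (fls_X * fls_deriv u)"
    by (simp add: zderiv_def power2_eq_square mult.assoc)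
  hence X: "fps_to_fls (fps_X * fps_deriv U) = - (fls_X_inv * zderiv u)"
    by (simp add: fls_X_inv_times_X u_def fls_deriv_fps_to_fls fls_times_fps_to_fls)
  have E: "fps_to_fls ?E = zderiv (zderiv (zderiv u)) + 6 * (zderiv u * zderiv u) - u
      - fls_X_inv * zderiv u"
    unfolding fps_to_fls_plus fps_to_fls_minus X
    by (simp add: u_def zderiv_fps_to_fls fls_times_fps_to_fls power2_eq_square)
  have "yv_inv n (yv (n - 1)) (yv n) (yv (Suc n))"
    using yv_inv_yv[of "n - 1"] assms(1) by simp
  from yv_log_deriv_ode[OF this yv_nonzero]
  have ode: "zderiv (zderiv (zderiv (zderiv u)))
      = fls_X_inv * zderiv (zderiv u) + 2 * zderiv u - 12 * zderiv u * zderiv (zderiv u)"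
    by (simp add: u_def U_def)
  show "zderiv (fps_to_fls ?E) = 0"
    unfolding E zderiv_add zderiv_diff zderiv_mult zderiv_X_inv zderiv_numeral ode by algebra
  \<comment> \<open>Derivatives in \<open>z\<close> start at \<open>X^2\<close> and
    \<open>U $ 0 = 0\<close>, so the constant of integration is zero.\<close>
  show "?E $ 0 = 0"
    by (simp add: zderiv_fps_nth U_def power_sum_fps_def)
qed

lemma yv_power_sum_initial_and_rec:
  assumes "n \<ge> 1"
  defines "s \<equiv> yv_power_sum n"
  shows yv_power_sum_1: "s 1 = 0" and yv_power_sum_2: "s 2 = 0"
    and yv_power_sum_rec: "of_nat (m + 3) * s (m + 3) = of_nat ((m + 1) * (m + 2) * (m + 3)) * s m
      - 6 * (\<Sum>i\<le>m. of_nat ((i + 1) * (m - i + 1)) * s i * s (m - i))"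
proof -
  define U where "U = power_sum_fps (proots (yv n))"
  \<comment> \<open>Chosen so that \<open>u' = - X^2 V\<close>.\<close>
  define V where "V = Abs_fps (\<lambda>k. of_nat (k + 1) * s k)"
  have U: "U $ Suc k = s k" for k
    by (simp add: U_def power_sum_fps_def s_def yv_power_sum_def)
  have "zderiv_fps U = - (fps_X ^ 2 * V)"
  proof (rule fps_ext)
    show "zderiv_fps U $ k = (- (fps_X ^ 2 * V)) $ k" for k
    proof (cases "k < 2")
      case False
      then obtain m where "k = m + 2" by (metis le_add_diff_inverse2 not_less)
      thus ?thesis by (simp add: zderiv_fps_nth V_def fps_X_power_mult_nth U)
    qed (simp add: zderiv_fps_nth fps_X_power_mult_nth)
  qed
  hence sq: "zderiv_fps U ^ 2 = fps_X ^ 4 * V ^ 2"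
    by (simp add: power_mult_distrib flip: power_mult)
  have E: "zderiv_fps (zderiv_fps (zderiv_fps U)) $ k + 6 * (if k < 4 then 0 else (V ^ 2) $ (k - 4))
      - U $ k + (fps_X * fps_deriv U) $ k = 0" for k
    using arg_cong[OF yv_log_deriv_ode_fps[OF assms(1), folded U_def], of "\<lambda>F. F $ k"]
    by (simp add: sq mult.assoc numeral_fps_const fps_X_power_mult_nth)
  \<comment> \<open>Both \<open>u'''\<close> and \<open>u'^2\<close> start at \<open>X^4\<close>.
    Below that only \<open>- U + X dU/dX\<close> contributes, with coefficient
    \<open>(k - 1) * s (k - 1)\<close> at \<open>X^k\<close>.\<close>
  from E[of 2] show "s 1 = 0"
    by (simp add: zderiv_fps_nth fps_X_power_mult_nth U numeral_eq_Suc)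
  from E[of 3] show "s 2 = 0"
    by (simp add: zderiv_fps_nth fps_X_power_mult_nth U numeral_eq_Suc)
  have sum: "(V ^ 2) $ m = (\<Sum>i\<le>m. of_nat ((i + 1) * (m - i + 1)) * s i * s (m - i))"
    unfolding power2_eq_square fps_mult_nth V_def atMost_atLeast0
    by (intro sum.cong refl) (simp only: fps_nth_Abs_fps of_nat_mult mult_ac)
  have U4: "U $ (m + 4) = s (m + 3)" using U[of "m + 3"] by (simp add: numeral_eq_Suc)
  \<comment> \<open>Each \<open>d/dz\<close> sends \<open>X^k\<close> to \<open>- k X^(k+1)\<close>;
    three of them act on the term \<open>s m * X^(m+1)\<close> of \<open>U\<close>.\<close>
  have D3: "zderiv_fps (zderiv_fps (zderiv_fps U)) $ (m + 4)
      = - of_nat ((m + 1) * (m + 2) * (m + 3)) * s m"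
    by (simp add: zderiv_fps_nth U numeral_eq_Suc algebra_simps)
  have D: "(fps_X * fps_deriv U) $ (m + 4) = of_nat (m + 4) * s (m + 3)"
    using U4 by (simp add: eval_nat_numeral)
  show "of_nat (m + 3) * s (m + 3) = of_nat ((m + 1) * (m + 2) * (m + 3)) * s m
      - 6 * (\<Sum>i\<le>m. of_nat ((i + 1) * (m - i + 1)) * s i * s (m - i))"
    using E[of "m + 4"] unfolding D3 D U4 sum[symmetric]
    by (simp add: fps_X_power_mult_nth algebra_simps)
qed

section \<open>Degrees and the zeroth power sum\<close>

text \<open>The term \<open>z q^2\<close> dominates: the derivative terms have degree at most
  \<open>2 * degree q\<close>.\<close>

lemma degree_yv_rhs:
  assumes "q \<noteq> 0" shows "degree (yv_rhs q) = 2 * degree q + 1"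
proof -
  have lead: "degree ([:0, 1:] * q ^ 2) = 2 * degree q + 1"
    using assms by (simp add: degree_mult_eq degree_power_eq)
  have "degree (q * pderiv (pderiv q)) \<le> 2 * degree q" "degree (pderiv q ^ 2) \<le> 2 * degree q"
    using degree_mult_le[of q "pderiv (pderiv q)"] degree_power_le[of "pderiv q" 2]
    by (simp_all add: degree_pderiv)
  hence "degree (q * pderiv (pderiv q) - pderiv q ^ 2) \<le> 2 * degree q"
    by (rule degree_diff_le)
  hence "degree (4 * (q * pderiv (pderiv q) - pderiv q ^ 2)) < degree ([:0, 1:] * q ^ 2)"
    using degree_mult_le[of 4 "q * pderiv (pderiv q) - pderiv q ^ 2"] lead
    by (simp only: degree_numeral)
  thus ?thesis unfolding yv_rhs_def diff_conv_add_uminus[of "[:0, 1:] * q ^ 2"]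
    by (subst degree_add_eq_left) (simp_all only: degree_minus lead)
qed

text \<open>Degrees add in the product form of the recurrence. Doubling avoids division in the
  naturals.\<close>

lemma degree_yv: "2 * degree (yv n) = n * (n + 1)"
proof (induction n rule: yv.induct)
  case (3 n)
  have "yv n * yv (Suc (Suc n)) = yv_rhs (yv (Suc n))"
    using yv_inv_yv[of n] by (simp add: yv_inv_def)
  hence "degree (yv n) + degree (yv (Suc (Suc n))) = 2 * degree (yv (Suc n)) + 1"
    using degree_mult_eq[OF yv_nonzero yv_nonzero, of n "Suc (Suc n)"] degree_yv_rhs[OF yv_nonzero]
    by (simp only:)
  hence "2 * degree (yv n) + 2 * degree (yv (Suc (Suc n))) = 2 * (2 * degree (yv (Suc n))) + 2"
    by linarith
  thus ?case unfolding "3.IH" by (simp only: algebra_simps) simp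
qed simp_all

lemma yv_power_sum_0: "yv_power_sum n 0 = of_nat n * (of_nat n + 1) / 2"
proof -
  have "2 * yv_power_sum n 0 = of_nat (2 * degree (yv n))"
    by (simp add: yv_power_sum_def size_proots_complex)
  thus ?thesis by (simp add: degree_yv algebra_simps)
qed

section \<open>Restriction to indices divisible by three\<close>

text \<open>If 3 does not divide \<open>k\<close>, it cannot divide both \<open>i\<close> and
  \<open>k - i\<close>, so inductively every term of the recurrence for index \<open>k + 3\<close>
  vanishes.\<close>

lemma yv_power_sum_not_dvd_3:
  assumes "n \<ge> 1" "\<not> 3 dvd m" shows "yv_power_sum n m = 0"
  using assms(2)
proof (induction m rule: less_induct)
  case (less m)
  show ?case
  proof (cases "m < 3")
    case True
    hence "m = 1 \<or> m = 2" using less.prems by (cases m) auto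
    thus ?thesis using yv_power_sum_1[OF assms(1)] yv_power_sum_2[OF assms(1)] by auto
  next
    case False
    then obtain k where m: "m = k + 3" by (metis le_add_diff_inverse2 not_less)
    have k: "\<not> 3 dvd k" using less.prems m by simp
    have "yv_power_sum n i * yv_power_sum n (k - i) = 0" if "i \<le> k" for i
    proof (cases "3 dvd i")
      case True
      hence "\<not> 3 dvd (k - i)" using k that by (metis dvd_diffD)
      thus ?thesis using less.IH[of "k - i"] m by simp
    qed (use less.IH[of i] m that in simp)
    hence "(\<Sum>i\<le>k. of_nat ((i + 1) * (k - i + 1)) * yv_power_sum n i * yv_power_sum n (k - i)) = 0"
      by (intro sum.neutral) (simp add: mult.assoc)
    moreover have "yv_power_sum n k = 0" using less.IH[of k] k m by simp
    ultimately have "of_nat (k + 3) * yv_power_sum n (k + 3) = 0"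
      using yv_power_sum_rec[OF assms(1), of k] by simp
    moreover have "of_nat (k + 3) \<noteq> (0 :: complex)" by (simp only: of_nat_eq_0_iff)
    ultimately show ?thesis using m by simp
  qed
qed

lemma yv_power_sum_rec_3:
  assumes "n \<ge> 1"
  defines "t \<equiv> \<lambda>j. yv_power_sum n (3 * j)"
  shows "of_nat (3 * j + 3) * t (Suc j) = of_nat ((3 * j + 1) * (3 * j + 2) * (3 * j + 3)) * t j
      - 6 * (\<Sum>i\<le>j. of_nat ((3 * i + 1) * (3 * (j - i) + 1)) * t i * t (j - i))"
proof -
  define f where "f = (\<lambda>i. of_nat ((i + 1) * (3 * j - i + 1)) * yv_power_sum n i
    * yv_power_sum n (3 * j - i))"
  have "sum f {..3 * j} = sum f ((*) 3 ` {..j})"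
  proof (rule sum.mono_neutral_right)
    have "\<not> 3 dvd i" if "i \<in> {..3 * j} - (*) 3 ` {..j}" for i
      using that by (auto elim!: dvdE)
    thus "\<forall>i\<in>{..3 * j} - (*) 3 ` {..j}. f i = 0"
      unfolding f_def using yv_power_sum_not_dvd_3[OF assms(1)] by simp
  qed auto
  also have "\<dots> = (\<Sum>i\<le>j. f (3 * i))"
    by (subst sum.reindex) (auto intro: inj_onI)
  also have "\<dots> = (\<Sum>i\<le>j. of_nat ((3 * i + 1) * (3 * (j - i) + 1)) * t i * t (j - i))"
    by (intro sum.cong) (simp_all add: f_def t_def diff_mult_distrib2)
  finally show ?thesis
    using yv_power_sum_rec[OF assms(1), of "3 * j"] by (simp add: t_def f_def add.commute)
qed

section \<open>Closed forms\<close>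

lemma sum_atMost_numeral:
  "sum f {..numeral k :: nat} = sum f {..pred_numeral k} + f (numeral k)"
  by (simp add: numeral_eq_Suc)

text \<open>\<open>P\<close> is \<open>yv_pi\<close> at \<open>n\<close>, because
  \<open>(n - 1)(n + 2) = K - 2\<close>. As \<open>s_0 = K/2\<close> and the recurrence has
  numerical coefficients, all power sums are polynomials in \<open>K\<close>, of half the degree in
  \<open>n\<close>.\<close>

lemma yv_power_sum_product_form:
  assumes "n \<ge> 1"
  defines "K \<equiv> of_nat n * (of_nat n + 1) :: complex"
  defines "P \<equiv> K * (K - 2)"
  shows
    "yv_power_sum n 3 = P * (- (1/2))"
    and "yv_power_sum n 6 = P * (2 * K - 10)"
    and "yv_power_sum n 9 = P * (- 12 * K^2 + 164 * K - 560)"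
    and "yv_power_sum n 12 = P * (88 * K^3 - 2336 * K^2 + 21120 * K - 61600)"
    and "yv_power_sum n 15 = P * (- 728 * K^4 + 32112 * K^3 - 552712 * K^2 + 4186000 * K - 11211200)"
    and "yv_power_sum n 18 = P * (6528 * K^5 - 435968 * K^4 + 12299936 * K^3 - 174981824 * K^2 +
      1201043200 * K - 3049446400)"
    and "yv_power_sum n 21 = P * (- 62016 * K^6 + 5888832 * K^5 - 249086016 * K^4 + 5752398592 * K^3 -
      73457400320 * K^2 + 473442547200 * K - 1158789632000)"
    and "yv_power_sum n 24 = P * (615296 * K^7 - 79364864 * K^6 + 4737981440 * K^5 - 162853266944 * K^4 +
      3351496894464 * K^3 - 39895528683520 * K^2 + 246068191846400 * K - 586347553792000)"
    and "yv_power_sum n 27 = P * (- 6314880 * K^8 + 1068543488 * K^7 - 86155582208 * K^6 +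
      4155891604736 * K^5 - 126575646500864 * K^4 + 2414418622592000 * K^3 - 27345639566182400 * K^2
      + 163251915706880000 * K - 381125909964800000)"
proof -
  note rec = yv_power_sum_rec_3[OF assms(1)]
  have s0: "yv_power_sum n 0 = K / 2" by (simp add: K_def yv_power_sum_0)
  \<comment> \<open>The recurrence reads \<open>3 s_3 = 6 s_0 - 6 s_0^2\<close>, which produces the
    factor \<open>K - 2\<close>. In the later instances every term contains some
    \<open>s_(3i)\<close> with \<open>i \<ge> 1\<close>, so \<open>P\<close> persists.\<close>
  show s3: "yv_power_sum n 3 = P * (- (1/2))"
    using rec[of 0]
    by (simp add: sum_atMost_numeral s0 P_def) algebra
  show s6: "yv_power_sum n 6 = P * (2 * K - 10)"
    using rec[of 1]
    by (simp add: sum_atMost_numeral s0 s3 P_def) algebra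
  show s9: "yv_power_sum n 9 = P * (- 12 * K^2 + 164 * K - 560)"
    using rec[of 2]
    by (simp add: sum_atMost_numeral s0 s3 s6 P_def) algebra
  show s12: "yv_power_sum n 12 = P * (88 * K^3 - 2336 * K^2 + 21120 * K - 61600)"
    using rec[of 3]
    by (simp add: sum_atMost_numeral s0 s3 s6 s9 P_def) algebra
  show s15: "yv_power_sum n 15 = P * (- 728 * K^4 + 32112 * K^3 - 552712 * K^2 + 4186000 * K -
      11211200)"
    using rec[of 4]
    by (simp add: sum_atMost_numeral s0 s3 s6 s9 s12 P_def) algebra
  show s18: "yv_power_sum n 18 = P * (6528 * K^5 - 435968 * K^4 + 12299936 * K^3 - 174981824 * K^2 +
      1201043200 * K - 3049446400)"
    using rec[of 5]
    by (simp add: sum_atMost_numeral s0 s3 s6 s9 s12 s15 P_def) algebra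
  show s21: "yv_power_sum n 21 = P * (- 62016 * K^6 + 5888832 * K^5 - 249086016 * K^4 +
      5752398592 * K^3 - 73457400320 * K^2 + 473442547200 * K - 1158789632000)"
    using rec[of 6]
    by (simp add: sum_atMost_numeral s0 s3 s6 s9 s12 s15 s18 P_def) algebra
  show s24: "yv_power_sum n 24 = P * (615296 * K^7 - 79364864 * K^6 + 4737981440 * K^5 -
      162853266944 * K^4 + 3351496894464 * K^3 - 39895528683520 * K^2 + 246068191846400 * K -
      586347553792000)"
    using rec[of 7]
    by (simp add: sum_atMost_numeral s0 s3 s6 s9 s12 s15 s18 s21 P_def) algebra
  show s27: "yv_power_sum n 27 = P * (- 6314880 * K^8 + 1068543488 * K^7 - 86155582208 * K^6 +
      4155891604736 * K^5 - 126575646500864 * K^4 + 2414418622592000 * K^3 - 27345639566182400 * K^2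
      + 163251915706880000 * K - 381125909964800000)"
    using rec[of 8]
    by (simp add: sum_atMost_numeral s0 s3 s6 s9 s12 s15 s18 s21 s24 P_def) algebra
qed

theorem mainTheorem5:
  fixes n :: nat
  assumes "n \<ge> 2"
  shows "let N = (of_nat n :: complex); P = yv_pi N in
      yv_power_sum n 3 = - (1/2) * P \<and>
      yv_power_sum n 6 = 2 * P * (N^2 + N - 5) \<and>
      yv_power_sum n 9 = - 4 * P * (N^2 + N - 7) * (3 * N^2 + 3 * N - 20) \<and>
      yv_power_sum n 12 = 8 * P * (11 * N^6 + 33 * N^5 - 259 * N^4 - 573 * N^3 + 2348 * N^2
         + 2640 * N - 7700) \<and>
      yv_power_sum n 15 = - 8 * P * (91 * N^8 + 364 * N^7 - 3468 * N^6 - 11678 * N^5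
         + 57138 * N^4 + 134164 * N^3 - 454161 * N^2 - 523250 * N + 1401400) \<and>
      yv_power_sum n 18 = 32 * P * (204 * N^10 + 1020 * N^9 - 11584 * N^8 - 52456 * N^7
         + 303649 * N^6 + 1098827 * N^5 - 4328687 * N^4 - 10551991 * N^3 + 32064418 * N^2
         + 37532600 * N - 95295200) \<and>
      yv_power_sum n 21 = - 64 * P * (969 * N^12 + 5814 * N^11 - 77478 * N^10 - 440685 * N^9
         + 2986374 * N^8 + 14653560 * N^7 - 66988510 * N^6 - 254167821 * N^5 + 882020165 * N^4
         + 2205662532 * N^3 - 6249767920 * N^2 - 7397539800 * N + 18106088000) \<and>
      yv_power_sum n 24 = 128 * P * (4807 * N^14 + 33649 * N^13 - 519091 * N^12
         - 3551983 * N^11 + 27883155 * N^10 + 172777587 * N^9 - 911403269 * N^8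
         - 4722725213 * N^7 + 18734279962 * N^6 + 73498559352 * N^5 - 234405400524 * N^4
         - 597184066192 * N^3 + 1610723930960 * N^2 + 1922407748800 * N - 4580840264000) \<and>
      yv_power_sum n 27 = - 128 * P * (49335 * N^16 + 394680 * N^15 - 6966616 * N^14
         - 55673212 * N^13 + 501236020 * N^12 + 3749125816 * N^11 - 22662344352 * N^10
         - 149052619326 * N^9 + 674231177321 * N^8 + 3634840116452 * N^7 - 13091078484596 * N^6
         - 52664915417010 * N^5 + 158038744882088 * N^4 + 408412972732600 * N^3
         - 1061767782349200 * N^2 - 1275405591460000 * N + 2977546171600000)"
proof -
  have n: "n \<ge> 1" using assms by simp
  \<comment> \<open>With \<open>K = N^2 + N\<close> substituted, each conjunct is a polynomial
    identity in \<open>N\<close>.\<close>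
  show ?thesis
    unfolding Let_def yv_pi_def yv_power_sum_product_form[OF n]
    by (intro conjI; algebra)
qed

end
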